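(* Let $\lambda\neq0$ be a real constant and let $\mu=\sqrt[3]{\lambda}$ be its real cube root. Up to changes of the pseudo-arc parameter, up to the orientation of the curve, and up to isometries of $\mathbb E^3_1$, the null curves in the 3-dimensional Minkowski spacetime $\mathbb E^3_1$ whose torsion is $\tau(s)=-2\lambda s$, where $s$ is a pseudo-arc parameter, are given (on their interval of definition) by the formula $\alpha(s)=(x(s),y(s),z(s))$ with $$x(s)=\frac{\pi}{\mu^2}\left(\mu s\,\mathrm{Ai}(\mu s)\,\mathrm{Bi}(\mu s)-\mathrm{Ai}'(\mu s)\,\mathrm{Bi}'(\mu s)\right),$$ $$y(s)=\frac{1}{2\mu^3}\left(\pi^2\left(\mu s\,\mathrm{Bi}^2(\mu s)-\mathrm{Bi}'^{\,2}(\mu s)\right)-\mu^3 s\,\mathrm{Ai}^2(\mu s)+\mu^2\,\mathrm{Ai}'^{\,2}(\mu s)\right),$$ $$z(s)=\frac{1}{2\mu^3}\left(\pi^2\left(\mu s\,\mathrm{Bi}^2(\mu s)-\mathrm{Bi}'^{\,2}(\mu s)\right)+\mu^3 s\,\mathrm{Ai}^2(\mu s)-\mu^2\,\mathrm{Ai}'^{\,2}(\mu s)\right).$$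
   Context: $\mathbb E^3_1$ denotes $\mathbb R^3$ with Cartesian coordinates $(x,y,z)$ and the Minkowski metric $g=dx^2+dy^2-dz^2$. All curves are smooth. A curve $\alpha\colon I\to\mathbb E^3_1$ ($I$ an open interval) is null if $g(\alpha',\alpha')=0$ on $I$. All null curves are assumed non-degenerate, i.e. $\alpha',\alpha'',\alpha'''$ are linearly independent at every point; then $g(\alpha'',\alpha'')>0$. All null curves are taken to be parametrized by a pseudo-arc parameter $s$, i.e. a parameter for which $g(\alpha'',\alpha'')=1$; such a parameter is unique up to changes $s\mapsto\pm s+\mathrm{const}$. The torsion of such a curve is $\tau=\tfrac12 g(\alpha''',\alpha''')$. The orientation of $\alpha$ is the sign of $\det[\alpha',\alpha'',\alpha''']$. Isometries of $\mathbb E^3_1$ are all affine maps whose linear part preserves $g$ (including orientation-reversing ones). Thus two curves are identified if one is obtained from the other by a change of parameter $s\mapsto\pm s+\mathrm{const}$ and an isometry of $\mathbb E^3_1$, possibly reversing the orientation of the curve. $\mathrm{Ai}$ and $\mathrm{Bi}$ are the standard Airy functions of the first and second kind (solutions of $w''(u)=u\,w(u)$, with Wronskian $\mathrm{Ai}\,\mathrm{Bi}'-\mathrm{Ai}'\,\mathrm{Bi}=1/\pi$); $\mathrm{Ai}'(\mu s)$ and $\mathrm{Bi}'(\mu s)$ denote the derivatives of $\mathrm{Ai}$ and $\mathrm{Bi}$ evaluated at $\mu s$. *)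

theory Defs
  imports "HOL-Analysis.Analysis"
begin

text \<open>
  The Maclaurin series of the solutions of \<open>w'' = u w\<close> with
  \<open>(w 0, w' 0) = (1, 0)\<close> (for \<open>r = 0\<close>) and \<open>(w 0, w' 0) = (0, 1)\<close> (for \<open>r = 1\<close>).
  Writing \<open>n = 3 k + r\<close>, the coefficient of \<open>u ^ n\<close> is
  \<open>3 ^ k * pochhammer ((r + 1) / 3) k / fact (3 k + r)\<close>, all others vanish.
\<close>

definition airy_coeff :: "nat \<Rightarrow> nat \<Rightarrow> real" where
  "airy_coeff r n =
     (if n mod 3 = r
      then 3 ^ (n div 3) * pochhammer (real (r + 1) / 3) (n div 3) / fact n
      else 0)"

definition airy_series :: "nat \<Rightarrow> real \<Rightarrow> real" where
  "airy_series r u = (\<Sum>n. airy_coeff r n * u ^ n)"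

text \<open>
  The standard normalisation
  \<open>Ai 0 = 1 / (3 powr (2/3) * Gamma (2/3))\<close>, \<open>Ai' 0 = - 1 / (3 powr (1/3) * Gamma (1/3))\<close>,
  \<open>Bi 0 = 1 / (3 powr (1/6) * Gamma (2/3))\<close>, \<open>Bi' 0 = 3 powr (1/6) / Gamma (1/3)\<close>.
\<close>

definition airy_Ai :: "real \<Rightarrow> real" where
  "airy_Ai u = airy_series 0 u / (3 powr (2/3) * Gamma (2/3))
             - airy_series 1 u / (3 powr (1/3) * Gamma (1/3))"

definition airy_Bi :: "real \<Rightarrow> real" where
  "airy_Bi u = airy_series 0 u / (3 powr (1/6) * Gamma (2/3))
             + airy_series 1 u * 3 powr (1/6) / Gamma (1/3)"

lemma airy_coeff_rec:
  assumes "r < 2"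
  shows "real (n + 3) * real (n + 2) * airy_coeff r (n + 3) = airy_coeff r n"
proof (cases "n mod 3 = r")
  case True
  define k where "k = n div 3"
  have n: "n = 3 * k + r"
    using True unfolding k_def by (metis mult_div_mod_eq)
  have d: "(n + 3) div 3 = Suc k" "(n + 3) mod 3 = r"
    using True by (auto simp: k_def)
  have f: "fact (n + 3) = (real (n + 3) * real (n + 2) * real (n + 1) * fact n :: real)"
    by (simp add: eval_nat_numeral algebra_simps)
  have p: "3 * (real (r + 1) / 3 + real k) = real (n + 1)"
    unfolding n by simp
  have "real (n + 3) * real (n + 2) * airy_coeff r (n + 3)
      = real (n + 3) * real (n + 2) * (3 ^ k * pochhammer (real (r + 1) / 3) k
          * (3 * (real (r + 1) / 3 + real k)))
        / (real (n + 3) * real (n + 2) * real (n + 1) * fact n)"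
    unfolding airy_coeff_def d f by (simp only: if_True pochhammer_Suc power_Suc refl) (simp add: mult_ac)
  also have "\<dots> = airy_coeff r n"
  proof -
    have "a * b * (x * c) / (a * b * c * d) = x / d" if "a > 0" "b > 0" "c > 0" for a b c d x :: real
      using that by simp
    from this[of "real (n + 3)" "real (n + 2)" "real (n + 1)"] show ?thesis
      unfolding p airy_coeff_def k_def[symmetric] using True by simp
  qed
  finally show ?thesis .
next
  case False
  thus ?thesis by (auto simp: airy_coeff_def)
qed

lemma summable_airy_coeff:
  assumes "r < 2"
  shows "summable (\<lambda>n. airy_coeff r n * u ^ n)"
proof -
  define a where "a = (\<lambda>k. airy_coeff r (3 * k + r) * u ^ (3 * k + r))"
  obtain N :: nat where N: "2 * \<bar>u\<bar> ^ 3 < real N"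
    using reals_Archimedean2 by blast
  have "summable a"
  proof (rule summable_ratio_test[where c = "1/2" and N = N])
    fix k assume k: "k \<ge> N"
    define m where "m = 3 * k + r"
    have e: "real (m + 3) * real (m + 2) * airy_coeff r (m + 3) = airy_coeff r m"
      by (rule airy_coeff_rec[OF assms])
    have s: "3 * Suc k + r = m + 3" by (simp add: m_def)
    have "2 * \<bar>u\<bar> ^ 3 \<le> real (m + 3) * 1"
      using N k by (simp add: m_def)
    also have "\<dots> \<le> real (m + 3) * real (m + 2)"
      by (intro mult_left_mono) auto
    finally have b: "2 * \<bar>u\<bar> ^ 3 \<le> real (m + 3) * real (m + 2)" .
    have "norm (a (Suc k)) = \<bar>airy_coeff r (m + 3)\<bar> * (\<bar>u\<bar> ^ 3 * \<bar>u\<bar> ^ m)"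
      unfolding a_def s by (simp add: abs_mult power_abs power_add)
    also have "\<dots> = 1/2 * (\<bar>airy_coeff r (m + 3)\<bar> * (2 * \<bar>u\<bar> ^ 3)) * \<bar>u\<bar> ^ m"
      by simp
    also have "\<dots> \<le> 1/2 * (\<bar>airy_coeff r (m + 3)\<bar> * (real (m + 3) * real (m + 2))) * \<bar>u\<bar> ^ m"
      using b by (intro mult_right_mono mult_left_mono) auto
    also have "\<bar>airy_coeff r (m + 3)\<bar> * (real (m + 3) * real (m + 2)) = \<bar>airy_coeff r m\<bar>"
      unfolding e[symmetric] by (simp add: abs_mult)
    also have "1/2 * \<bar>airy_coeff r m\<bar> * \<bar>u\<bar> ^ m = 1/2 * norm (a k)"
      by (simp add: a_def m_def abs_mult power_abs)
    finally show "norm (a (Suc k)) \<le> 1/2 * norm (a k)" .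
  qed simp
  moreover have "strict_mono (\<lambda>k. 3 * k + r)"
    by (simp add: strict_mono_def)
  moreover have "airy_coeff r n * u ^ n = 0" if "n \<notin> range (\<lambda>k. 3 * k + r)" for n
  proof -
    have "n mod 3 \<noteq> r"
      using that by (metis mult_div_mod_eq rangeI)
    thus ?thesis by (simp add: airy_coeff_def)
  qed
  ultimately show ?thesis
    unfolding a_def by (subst summable_mono_reindex[of "\<lambda>k. 3 * k + r", symmetric]) auto
qed

lemma airy_series_ode:
  assumes "r < 2"
  shows "(airy_series r has_field_derivative deriv (airy_series r) u) (at u)"
    and "(deriv (airy_series r) has_field_derivative u * airy_series r u) (at u)"
proof -
  have 1: "(airy_series r has_field_derivative (\<Sum>n. diffs (airy_coeff r) n * x ^ n)) (at x)" for x
    unfolding airy_series_def[abs_def]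
    by (rule termdiffs_strong_converges_everywhere) (rule summable_airy_coeff[OF assms])
  have D: "deriv (airy_series r) = (\<lambda>x. \<Sum>n. diffs (airy_coeff r) n * x ^ n)"
    using 1 by (intro ext DERIV_imp_deriv)
  show "(airy_series r has_field_derivative deriv (airy_series r) u) (at u)"
    using 1[of u] by (simp add: D)
  have S1: "summable (\<lambda>n. diffs (airy_coeff r) n * x ^ n)" for x
    by (rule termdiff_converges_all) (rule summable_airy_coeff[OF assms])
  have 2: "(deriv (airy_series r) has_field_derivative
            (\<Sum>n. diffs (diffs (airy_coeff r)) n * u ^ n)) (at u)"
    unfolding D by (rule termdiffs_strong_converges_everywhere) (rule S1)
  have S2: "summable (\<lambda>n. diffs (diffs (airy_coeff r)) n * u ^ n)"
    by (rule termdiff_converges_all) (rule S1)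
  have z: "diffs (diffs (airy_coeff r)) 0 = 0"
    using assms by (auto simp: diffs_def airy_coeff_def numeral_2_eq_2)
  have s: "diffs (diffs (airy_coeff r)) (Suc n) = airy_coeff r n" for n
    using airy_coeff_rec[OF assms, of n]
    by (simp add: diffs_def eval_nat_numeral algebra_simps)
  have "(\<Sum>n. diffs (diffs (airy_coeff r)) n * u ^ n)
      = (\<Sum>n. u * (airy_coeff r n * u ^ n))"
    using suminf_split_head[OF S2] by (simp add: z s mult_ac)
  also have "\<dots> = u * airy_series r u"
    unfolding airy_series_def by (rule suminf_mult) (rule summable_airy_coeff[OF assms])
  finally show "(deriv (airy_series r) has_field_derivative u * airy_series r u) (at u)"
    using 2 by simp
qed

lemma airy_series_0:
  "airy_series 0 0 = 1" "deriv (airy_series 0) 0 = 0"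
  "airy_series 1 0 = 0" "deriv (airy_series 1) 0 = 1"
proof -
  have d: "deriv (airy_series r) 0 = airy_coeff r 1" if "r < 2" for r
  proof -
    have "(airy_series r has_field_derivative (\<Sum>n. diffs (airy_coeff r) n * 0 ^ n)) (at 0)"
      unfolding airy_series_def[abs_def]
      by (rule termdiffs_strong_converges_everywhere) (rule summable_airy_coeff[OF that])
    from DERIV_imp_deriv[OF this] show ?thesis
      by (simp add: powser_zero diffs_def)
  qed
  show "airy_series 0 0 = 1" "airy_series 1 0 = 0"
    by (simp_all add: airy_series_def powser_zero airy_coeff_def)
  show "deriv (airy_series 0) 0 = 0" "deriv (airy_series 1) 0 = 1"
    by (simp_all add: d airy_coeff_def)
qed

lemma airy_Ai_ode:
  "(airy_Ai has_field_derivative deriv airy_Ai u) (at u)"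
  "(deriv airy_Ai has_field_derivative u * airy_Ai u) (at u)"
  and deriv_airy_Ai:
  "deriv airy_Ai u = deriv (airy_series 0) u / (3 powr (2/3) * Gamma (2/3))
                   - deriv (airy_series 1) u / (3 powr (1/3) * Gamma (1/3))"
proof -
  have 1: "(airy_Ai has_field_derivative
         deriv (airy_series 0) x / (3 powr (2/3) * Gamma (2/3))
       - deriv (airy_series 1) x / (3 powr (1/3) * Gamma (1/3))) (at x)" for x
    unfolding airy_Ai_def[abs_def]
    by (intro DERIV_diff DERIV_cdivide airy_series_ode) auto
  have D: "deriv airy_Ai = (\<lambda>x. deriv (airy_series 0) x / (3 powr (2/3) * Gamma (2/3))
       - deriv (airy_series 1) x / (3 powr (1/3) * Gamma (1/3)))"
    using 1 by (intro ext DERIV_imp_deriv)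
  show "deriv airy_Ai u = deriv (airy_series 0) u / (3 powr (2/3) * Gamma (2/3))
                   - deriv (airy_series 1) u / (3 powr (1/3) * Gamma (1/3))"
    by (simp add: D)
  show "(airy_Ai has_field_derivative deriv airy_Ai u) (at u)"
    using 1[of u] by (simp add: D)
  have "(deriv airy_Ai has_field_derivative
         u * airy_series 0 u / (3 powr (2/3) * Gamma (2/3))
       - u * airy_series 1 u / (3 powr (1/3) * Gamma (1/3))) (at u)"
    unfolding D by (intro DERIV_diff DERIV_cdivide airy_series_ode) auto
  thus "(deriv airy_Ai has_field_derivative u * airy_Ai u) (at u)"
    by (simp add: airy_Ai_def right_diff_distrib)
qed

lemma airy_Bi_ode:
  "(airy_Bi has_field_derivative deriv airy_Bi u) (at u)"
  "(deriv airy_Bi has_field_derivative u * airy_Bi u) (at u)"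
  and deriv_airy_Bi:
  "deriv airy_Bi u = deriv (airy_series 0) u / (3 powr (1/6) * Gamma (2/3))
                   + deriv (airy_series 1) u * 3 powr (1/6) / Gamma (1/3)"
proof -
  have 1: "(airy_Bi has_field_derivative
         deriv (airy_series 0) x / (3 powr (1/6) * Gamma (2/3))
       + deriv (airy_series 1) x * 3 powr (1/6) / Gamma (1/3)) (at x)" for x
    unfolding airy_Bi_def[abs_def]
    by (intro DERIV_add DERIV_cdivide DERIV_cmult_right airy_series_ode) auto
  have D: "deriv airy_Bi = (\<lambda>x. deriv (airy_series 0) x / (3 powr (1/6) * Gamma (2/3))
       + deriv (airy_series 1) x * 3 powr (1/6) / Gamma (1/3))"
    using 1 by (intro ext DERIV_imp_deriv)
  show "deriv airy_Bi u = deriv (airy_series 0) u / (3 powr (1/6) * Gamma (2/3))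
                   + deriv (airy_series 1) u * 3 powr (1/6) / Gamma (1/3)"
    by (simp add: D)
  show "(airy_Bi has_field_derivative deriv airy_Bi u) (at u)"
    using 1[of u] by (simp add: D)
  have "(deriv airy_Bi has_field_derivative
         u * airy_series 0 u / (3 powr (1/6) * Gamma (2/3))
       + u * airy_series 1 u * 3 powr (1/6) / Gamma (1/3)) (at u)"
    unfolding D by (intro DERIV_add DERIV_cdivide DERIV_cmult_right airy_series_ode) auto
  thus "(deriv airy_Bi has_field_derivative u * airy_Bi u) (at u)"
    by (simp add: airy_Bi_def distrib_left mult_ac)
qed

lemma Gamma_third: "Gamma (1/3) * Gamma (2/3) = 2 * pi / sqrt (3 :: real)"
proof -
  have r: "Gamma (complex_of_real x) * Gamma (1 - complex_of_real x)
      = of_real pi / sin (of_real pi * complex_of_real x)" for x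
    by (rule Gamma_reflection_complex)
  have "complex_of_real (Gamma x * Gamma (1 - x)) = complex_of_real (pi / sin (pi * x))" for x
    using r[of x] by (metis Gamma_complex_of_real of_real_1 of_real_diff of_real_divide of_real_mult sin_of_real)
  from this[of "1/3"] have "Gamma (1/3) * Gamma (2/3) = pi / sin (pi / 3)"
    unfolding of_real_eq_iff by simp
  thus ?thesis by (simp add: sin_60)
qed

lemma airy_wronskian: "airy_Ai u * deriv airy_Bi u - deriv airy_Ai u * airy_Bi u = 1 / pi"
proof -
  let ?W = "\<lambda>u. airy_Ai u * deriv airy_Bi u - deriv airy_Ai u * airy_Bi u"
  have "(?W has_field_derivative 0) (at x)" for x
    by (rule derivative_eq_intros airy_Ai_ode airy_Bi_ode refl | simp add: algebra_simps)+
  hence "?W u = ?W 0"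
    by (intro DERIV_isconst_all) auto
  also have "?W 0 = 1 / pi"
  proof -
    have a: "airy_Ai 0 = 1 / (3 powr (2/3) * Gamma (2/3))"
      and b: "airy_Bi 0 = 1 / (3 powr (1/6) * Gamma (2/3))"
      and c: "deriv airy_Ai 0 = - 1 / (3 powr (1/3) * Gamma (1/3))"
      and d: "deriv airy_Bi 0 = 3 powr (1/6) / Gamma (1/3)"
      using airy_series_0 by (simp_all add: airy_Ai_def airy_Bi_def deriv_airy_Ai deriv_airy_Bi)
    define G where "G = Gamma (1/3) * Gamma (2/3 :: real)"
    have p1: "3 powr (1/6) / 3 powr (2/3) = (1 / sqrt 3 :: real)"
      by (simp add: powr_half_sqrt[symmetric] powr_diff[symmetric] powr_minus_divide[symmetric])
    have p2: "3 powr (1/3) * 3 powr (1/6) = (sqrt 3 :: real)"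
      by (simp add: powr_half_sqrt[symmetric] powr_add[symmetric])
    have "?W 0 = (3 powr (1/6) / 3 powr (2/3)) / G + 1 / ((3 powr (1/3) * 3 powr (1/6)) * G)"
      unfolding a b c d G_def by (simp add: field_simps)
    also have "\<dots> = 2 / (sqrt 3 * G)"
      unfolding p1 p2 by simp
    also have "\<dots> = 1 / pi"
      unfolding G_def Gamma_third by simp
    finally show ?thesis .
  qed
  finally show ?thesis .
qed

definition minkowski :: "real ^ 3 \<Rightarrow> real ^ 3 \<Rightarrow> real" where
  "minkowski v w = v $ 1 * w $ 1 + v $ 2 * w $ 2 - v $ 3 * w $ 3"

text \<open>No condition on the determinant or on time-orientation: all isometries are allowed.\<close>

definition minkowski_isometry :: "(real ^ 3 \<Rightarrow> real ^ 3) \<Rightarrow> bool" where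
  "minkowski_isometry F \<longleftrightarrow>
     (\<exists>L b. linear L \<and> (\<forall>v w. minkowski (L v) (L w) = minkowski v w) \<and> F = (\<lambda>p. L p + b))"

definition open_interval :: "real set \<Rightarrow> bool" where
  "open_interval I \<longleftrightarrow> open I \<and> is_interval I \<and> I \<noteq> {}"

text \<open>
  A curve on \<open>I\<close> is a total function of which only the values on \<open>I\<close> matter; as \<open>I\<close> is
  open, the derivatives at points of \<open>I\<close> depend only on these values.
\<close>

definition curve_deriv :: "nat \<Rightarrow> (real \<Rightarrow> real ^ 3) \<Rightarrow> real \<Rightarrow> real ^ 3" where
  "curve_deriv n \<alpha> = ((\<lambda>\<beta> t. vector_derivative \<beta> (at t)) ^^ n) \<alpha>"

definition smooth_curve :: "real set \<Rightarrow> (real \<Rightarrow> real ^ 3) \<Rightarrow> bool" where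
  "smooth_curve I \<alpha> \<longleftrightarrow> (\<forall>n. \<forall>t\<in>I. curve_deriv n \<alpha> differentiable (at t))"

definition null_curve :: "real set \<Rightarrow> (real \<Rightarrow> real ^ 3) \<Rightarrow> bool" where
  "null_curve I \<alpha> \<longleftrightarrow> open_interval I \<and> smooth_curve I \<alpha> \<and>
     (\<forall>t\<in>I. minkowski (curve_deriv 1 \<alpha> t) (curve_deriv 1 \<alpha> t) = 0)"

definition nondegenerate_curve :: "real set \<Rightarrow> (real \<Rightarrow> real ^ 3) \<Rightarrow> bool" where
  "nondegenerate_curve I \<alpha> \<longleftrightarrow>
     (\<forall>t\<in>I. \<forall>a b c. a *\<^sub>R curve_deriv 1 \<alpha> t + b *\<^sub>R curve_deriv 2 \<alpha> t + c *\<^sub>R curve_deriv 3 \<alpha> t = 0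
        \<longrightarrow> a = 0 \<and> b = 0 \<and> c = 0)"

definition pseudo_arc_param :: "real set \<Rightarrow> (real \<Rightarrow> real ^ 3) \<Rightarrow> bool" where
  "pseudo_arc_param I \<alpha> \<longleftrightarrow>
     (\<forall>t\<in>I. minkowski (curve_deriv 2 \<alpha> t) (curve_deriv 2 \<alpha> t) = 1)"

definition pseudo_arc_null_curve :: "real set \<Rightarrow> (real \<Rightarrow> real ^ 3) \<Rightarrow> bool" where
  "pseudo_arc_null_curve I \<alpha> \<longleftrightarrow>
     null_curve I \<alpha> \<and> nondegenerate_curve I \<alpha> \<and> pseudo_arc_param I \<alpha>"

definition torsion :: "(real \<Rightarrow> real ^ 3) \<Rightarrow> real \<Rightarrow> real" where
  "torsion \<alpha> s = 1/2 * minkowski (curve_deriv 3 \<alpha> s) (curve_deriv 3 \<alpha> s)"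

definition pseudo_arc_change :: "(real \<Rightarrow> real) \<Rightarrow> bool" where
  "pseudo_arc_change \<phi> \<longleftrightarrow> (\<exists>c. \<phi> = (\<lambda>s. s + c) \<or> \<phi> = (\<lambda>s. - s + c))"

definition equivalent_curves ::
    "real set \<Rightarrow> (real \<Rightarrow> real ^ 3) \<Rightarrow> real set \<Rightarrow> (real \<Rightarrow> real ^ 3) \<Rightarrow> bool" where
  "equivalent_curves I \<alpha> J \<beta> \<longleftrightarrow>
     (\<exists>\<phi> F. pseudo_arc_change \<phi> \<and> minkowski_isometry F \<and> \<phi> ` I = J \<and> (\<forall>t\<in>I. \<alpha> t = F (\<beta> (\<phi> t))))"

definition airy_null_curve :: "real \<Rightarrow> real \<Rightarrow> real ^ 3" where
  "airy_null_curve lam s =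
     (let \<mu> = root 3 lam;
          A = airy_Ai (\<mu> * s); B = airy_Bi (\<mu> * s);
          A' = deriv airy_Ai (\<mu> * s); B' = deriv airy_Bi (\<mu> * s)
      in vector
        [pi / \<mu>^2 * (\<mu> * s * A * B - A' * B'),
         1 / (2 * \<mu>^3) * (pi^2 * (\<mu> * s * B^2 - B'^2) - \<mu>^3 * s * A^2 + \<mu>^2 * A'^2),
         1 / (2 * \<mu>^3) * (pi^2 * (\<mu> * s * B^2 - B'^2) + \<mu>^3 * s * A^2 - \<mu>^2 * A'^2)])"

end

theory Submission
  imports Defs
begin

text \<open>
  The Gram matrix of \<open>\<alpha>'\<close>, \<open>\<alpha>''\<close>, \<open>\<alpha>'''\<close> along a pseudo-arc null curve depends on the
  torsion \<open>\<tau>\<close> only, which forces \<open>\<alpha>'''' = - \<tau>' \<alpha>' - 2 \<tau> \<alpha>''\<close>. For two curves with the same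
  torsion, the linear map carrying one frame to the other is therefore an isometry; written with
  the metric as in \<open>frame_map\<close>, its derivative in the parameter vanishes, so it is a single
  isometry and the curves are congruent. The Airy curve comes from \<open>p = Ai (\<mu> s)\<close> and
  \<open>q = \<pi> / \<mu> Bi (\<mu> s)\<close>, two solutions of \<open>w'' = \<lambda> s w\<close> with Wronskian 1: its tangent is
  \<open>(p q, (q\<^sup>2 - p\<^sup>2) / 2, (q\<^sup>2 + p\<^sup>2) / 2)\<close>, the quadratic parametrization of the light cone.
\<close>

section \<open>The Minkowski form and null frames\<close>

lemma bounded_bilinear_minkowski: "bounded_bilinear minkowski"
proof -
  have "bilinear minkowski"
    unfolding bilinear_def minkowski_def
    by (auto intro!: linearI simp: algebra_simps)
  then show ?thesis
    by (simp add: bilinear_conv_bounded_bilinear)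
qed

interpretation minkowski: bounded_bilinear minkowski
  by (rule bounded_bilinear_minkowski)

lemma minkowski_commute: "minkowski v w = minkowski w v"
  by (simp add: minkowski_def mult.commute)

lemmas minkowski_linear = minkowski.add_left minkowski.add_right minkowski.diff_left
  minkowski.diff_right minkowski.scaleR_left minkowski.scaleR_right

lemma minkowski_nondegenerate:
  assumes "\<And>w. minkowski v w = 0"
  shows "v = 0"
  using assms[of "axis 1 1"] assms[of "axis 2 1"] assms[of "axis 3 1"]
  by (simp add: minkowski_def vec_eq_iff forall_3 axis_def)

text \<open>The Gram matrix of the first three derivatives of a pseudo-arc null curve with torsion
  \<open>k\<close>. The third vector is the raw third derivative rather than the null binormal of a
  Cartan frame; the latter is, up to sign, \<open>D + k T\<close>.\<close>

definition null_frame :: "real ^ 3 \<Rightarrow> real ^ 3 \<Rightarrow> real ^ 3 \<Rightarrow> real \<Rightarrow> bool" where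
  "null_frame T N D k \<longleftrightarrow>
     minkowski T T = 0 \<and> minkowski T N = 0 \<and> minkowski N N = 1 \<and>
     minkowski T D = - 1 \<and> minkowski N D = 0 \<and> minkowski D D = 2 * k"

lemma null_frame_gram:
  assumes "null_frame T N D k"
  shows "minkowski T T = 0" "minkowski T N = 0" "minkowski N T = 0" "minkowski N N = 1"
    "minkowski T D = - 1" "minkowski D T = - 1" "minkowski N D = 0" "minkowski D N = 0"
    "minkowski D D = 2 * k"
  using assms unfolding null_frame_def by (simp_all add: minkowski_commute)

text \<open>Pairing the relation with \<open>T\<close>, \<open>N\<close> and \<open>D\<close> in
  turn gives \<open>c = 0\<close>, \<open>b = 0\<close> and then \<open>a = 0\<close>: the Gram
  matrix has determinant -1 whatever \<open>k\<close> is.\<close>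

lemma null_frame_independent:
  assumes F: "null_frame T N D k" and z: "a *\<^sub>R T + b *\<^sub>R N + c *\<^sub>R D = 0"
  shows "a = 0 \<and> b = 0 \<and> c = 0"
proof -
  have "minkowski (a *\<^sub>R T + b *\<^sub>R N + c *\<^sub>R D) v = 0" for v
    by (simp add: z minkowski.zero_left)
  from this[of T] this[of N] this[of D] show ?thesis
    by (simp add: minkowski_linear null_frame_gram[OF F])
qed

text \<open>Three independent vectors span the space, so \<open>v\<close> is a combination of the
  frame; pairing it with \<open>T\<close>, \<open>N\<close> and \<open>D\<close> identifies the
  coefficients, which come from the inverse Gram matrix.\<close>

lemma null_frame_expansion:
  assumes F: "null_frame T N D k"
  shows "v = (- 2 * k * minkowski v T - minkowski v D) *\<^sub>R T + minkowski v N *\<^sub>R N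
             - minkowski v T *\<^sub>R D"
proof -
  define f where "f = (\<lambda>x :: real ^ 3. x $ 1 *\<^sub>R T + x $ 2 *\<^sub>R N + x $ 3 *\<^sub>R D)"
  have lin: "linear f"
    unfolding f_def by (auto intro!: linearI simp: algebra_simps)
  have "inj f"
    unfolding linear_injective_0[OF lin]
  proof (intro allI impI)
    fix x assume "f x = 0"
    then have "x $ 1 = 0 \<and> x $ 2 = 0 \<and> x $ 3 = 0"
      unfolding f_def by (rule null_frame_independent[OF F])
    then show "x = 0"
      by (simp add: vec_eq_iff forall_3)
  qed
  then have "surj f"
    using lin linear_injective_imp_surjective by blast
  then obtain x where x: "v = f x"
    by (meson surjD)
  show ?thesis
    unfolding x f_def by (simp add: minkowski_linear null_frame_gram[OF F])
qed

text \<open>The expansion of \<open>v\<close> in the first frame, with the second frame substituted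
  for the basis vectors. Since the coefficients are metric products, the map can be differentiated
  term by term when both frames move.\<close>

definition frame_map ::
    "real ^ 3 \<Rightarrow> real ^ 3 \<Rightarrow> real ^ 3 \<Rightarrow> real ^ 3 \<Rightarrow> real ^ 3 \<Rightarrow> real ^ 3 \<Rightarrow> real \<Rightarrow> real ^ 3 \<Rightarrow> real ^ 3"
  where "frame_map T N D T' N' D' k v =
    (- 2 * k * minkowski v T - minkowski v D) *\<^sub>R T' + minkowski v N *\<^sub>R N' - minkowski v T *\<^sub>R D'"

lemma linear_frame_map: "linear (frame_map T N D T' N' D' k)"
  unfolding frame_map_def
  by (auto intro!: linearI simp: minkowski_linear algebra_simps)

text \<open>Once \<open>v\<close> and \<open>w\<close> are expanded in the first frame, their
  product depends only on the coefficients and the Gram matrix, and the two frames share the Gram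
  matrix because they share \<open>k\<close>.\<close>

lemma frame_map_isometric:
  assumes F: "null_frame T N D k" and F': "null_frame T' N' D' k"
  shows "minkowski (frame_map T N D T' N' D' k v) (frame_map T N D T' N' D' k w) = minkowski v w"
proof -
  have "minkowski v w =
    minkowski ((- 2 * k * minkowski v T - minkowski v D) *\<^sub>R T + minkowski v N *\<^sub>R N
                 - minkowski v T *\<^sub>R D)
      ((- 2 * k * minkowski w T - minkowski w D) *\<^sub>R T + minkowski w N *\<^sub>R N
                 - minkowski w T *\<^sub>R D)"
    using null_frame_expansion[OF F] by metis
  then show ?thesis
    unfolding frame_map_def
    by (simp only: minkowski_linear null_frame_gram[OF F] null_frame_gram[OF F'])
qed

section \<open>Derivatives of curves\<close>

declare One_nat_def [simp del]

lemma curve_deriv_0 [simp]: "curve_deriv 0 \<alpha> = \<alpha>"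
  by (simp add: curve_deriv_def)

lemma curve_deriv_Suc: "curve_deriv (Suc n) \<alpha> t = vector_derivative (curve_deriv n \<alpha>) (at t)"
  by (simp add: curve_deriv_def)

lemma smooth_curve_has_vector_derivative:
  assumes "smooth_curve I \<alpha>" "t \<in> I"
  shows "(curve_deriv n \<alpha> has_vector_derivative curve_deriv (Suc n) \<alpha> t) (at t)"
  using assms unfolding smooth_curve_def curve_deriv_Suc
  by (simp add: vector_derivative_works)

lemma smooth_curve_derivs:
  assumes "smooth_curve I \<alpha>" "t \<in> I"
  shows "(curve_deriv 1 \<alpha> has_vector_derivative curve_deriv 2 \<alpha> t) (at t)"
    and "(curve_deriv 2 \<alpha> has_vector_derivative curve_deriv 3 \<alpha> t) (at t)"
    and "(curve_deriv 3 \<alpha> has_vector_derivative curve_deriv 4 \<alpha> t) (at t)"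
    and "(\<alpha> has_vector_derivative curve_deriv 1 \<alpha> t) (at t)"
  using smooth_curve_has_vector_derivative[OF assms, of 0]
    smooth_curve_has_vector_derivative[OF assms, of 1]
    smooth_curve_has_vector_derivative[OF assms, of 2]
    smooth_curve_has_vector_derivative[OF assms, of 3]
  by (simp_all add: eval_nat_numeral One_nat_def)

lemma smooth_curveI:
  assumes "\<And>n t. t \<in> I \<Longrightarrow> \<exists>v. (curve_deriv n \<alpha> has_vector_derivative v) (at t)"
  shows "smooth_curve I \<alpha>"
  using assms unfolding smooth_curve_def by (meson differentiableI_vector)

text \<open>By the chain rule each differentiation contributes one factor \<open>e\<close> and
  commutes with \<open>L\<close>, while the translation \<open>b\<close> survives at order 0 only.
  The second claim also records differentiability at each order, hence smoothness of the new
  curve.\<close>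

lemma curve_deriv_affine:
  assumes sm: "smooth_curve J \<gamma>" and I: "open I" and L: "linear L"
    and maps: "\<And>t. t \<in> I \<Longrightarrow> e * t + c \<in> J"
    and eq: "\<And>t. t \<in> I \<Longrightarrow> \<alpha> t = L (\<gamma> (e * t + c)) + b"
    and t: "t \<in> I"
  shows "curve_deriv n \<alpha> t = e ^ n *\<^sub>R L (curve_deriv n \<gamma> (e * t + c)) + (if n = 0 then b else 0)"
    and "(curve_deriv n \<alpha> has_vector_derivative
            e ^ Suc n *\<^sub>R L (curve_deriv (Suc n) \<gamma> (e * t + c))) (at t)"
proof -
  have bl: "bounded_linear L"
    using L by (simp add: linear_conv_bounded_linear)
  have step: "(curve_deriv n \<alpha> has_vector_derivative
            e ^ Suc n *\<^sub>R L (curve_deriv (Suc n) \<gamma> (e * t + c))) (at t)"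
    if *: "\<And>t. t \<in> I \<Longrightarrow> curve_deriv n \<alpha> t =
             e ^ n *\<^sub>R L (curve_deriv n \<gamma> (e * t + c)) + (if n = 0 then b else 0)"
      and t: "t \<in> I" for n t
  proof -
    have "((curve_deriv n \<gamma> \<circ> (\<lambda>t. e * t + c)) has_vector_derivative
            e *\<^sub>R curve_deriv (Suc n) \<gamma> (e * t + c)) (at t)"
      using smooth_curve_has_vector_derivative[OF sm maps[OF t]]
      by (intro vector_diff_chain_at)
        (auto intro!: derivative_eq_intros simp flip: has_real_derivative_iff_has_vector_derivative)
    from bounded_linear.has_vector_derivative[OF bl this]
    have "((\<lambda>t. e ^ n *\<^sub>R L (curve_deriv n \<gamma> (e * t + c)) + (if n = 0 then b else 0))
        has_vector_derivative e ^ n *\<^sub>R L (e *\<^sub>R curve_deriv (Suc n) \<gamma> (e * t + c)) + 0) (at t)"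
      unfolding o_def
      by (intro has_vector_derivative_add has_vector_derivative_const
        bounded_linear.has_vector_derivative[OF bounded_linear_scaleR_right])
    then have "((\<lambda>t. e ^ n *\<^sub>R L (curve_deriv n \<gamma> (e * t + c)) + (if n = 0 then b else 0))
        has_vector_derivative e ^ Suc n *\<^sub>R L (curve_deriv (Suc n) \<gamma> (e * t + c))) (at t)"
      by (simp add: linear_scale[OF L] mult.commute)
    \<comment> \<open>The formula of order \<open>n\<close> is known on \<open>I\<close> only; as
      \<open>I\<close> is open, this determines the derivative at \<open>t\<close>.\<close>
    then show ?thesis
      using I t by (rule has_vector_derivative_transform_within_open) (simp add: *)
  qed
  have formula: "curve_deriv n \<alpha> t =
      e ^ n *\<^sub>R L (curve_deriv n \<gamma> (e * t + c)) + (if n = 0 then b else 0)" if "t \<in> I" for n t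
    using that
  proof (induction n arbitrary: t)
    case 0
    then show ?case by (simp add: eq)
  next
    case (Suc n)
    show ?case
      using vector_derivative_at[OF step[OF Suc.IH Suc.prems]] by (simp add: curve_deriv_Suc)
  qed
  show "curve_deriv n \<alpha> t = e ^ n *\<^sub>R L (curve_deriv n \<gamma> (e * t + c)) + (if n = 0 then b else 0)"
    by (rule formula[OF t])
  show "(curve_deriv n \<alpha> has_vector_derivative
            e ^ Suc n *\<^sub>R L (curve_deriv (Suc n) \<gamma> (e * t + c))) (at t)"
    by (rule step[OF formula t])
qed

section \<open>Rigidity of pseudo-arc null curves\<close>

text \<open>Squared lengths of derivatives pick up the factor \<open>e ^ n * e ^ n = 1\<close>, so
  the pseudo-arc normalization and the torsion survive even a reversal of the parameter.\<close>

lemma pseudo_arc_null_curve_affine: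
  assumes \<gamma>: "pseudo_arc_null_curve J \<gamma>" and I: "open_interval I" and L: "linear L"
    and iso: "\<And>v w. minkowski (L v) (L w) = minkowski v w"
    and e: "e = 1 \<or> e = - 1"
    and maps: "\<And>t. t \<in> I \<Longrightarrow> e * t + c \<in> J"
    and eq: "\<And>t. t \<in> I \<Longrightarrow> \<alpha> t = L (\<gamma> (e * t + c)) + b"
  shows "pseudo_arc_null_curve I \<alpha>"
    and "t \<in> I \<Longrightarrow> torsion \<alpha> t = torsion \<gamma> (e * t + c)"
proof -
  have sm: "smooth_curve J \<gamma>" and oI: "open I"
    using \<gamma> I by (auto simp: pseudo_arc_null_curve_def null_curve_def open_interval_def)
  note aff = curve_deriv_affine[OF sm oI L maps eq]
  have cd: "curve_deriv n \<alpha> t = e ^ n *\<^sub>R L (curve_deriv n \<gamma> (e * t + c))" if "t \<in> I" "n > 0" for n t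
    using aff(1)[of t n] that by auto
  have ee: "e * e = 1" and e0: "e \<noteq> 0"
    using e by auto
  have gram: "minkowski (curve_deriv n \<alpha> t) (curve_deriv n \<alpha> t)
      = minkowski (curve_deriv n \<gamma> (e * t + c)) (curve_deriv n \<gamma> (e * t + c))"
    if "t \<in> I" "n > 0" for n t
  proof -
    have "e ^ n * e ^ n = 1"
      by (simp add: ee flip: power_mult_distrib)
    then show ?thesis
      by (simp add: cd[OF that] minkowski_linear iso flip: mult.assoc)
  qed
  \<comment> \<open>If \<open>L v = 0\<close>, then \<open>v\<close> is orthogonal to every vector,
    and the metric is nondegenerate.\<close>
  have inj: "v = 0" if "L v = 0" for v
    using that by (intro minkowski_nondegenerate) (metis iso minkowski.zero_left)
  have "smooth_curve I \<alpha>"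
    using aff(2) by (intro smooth_curveI) blast
  moreover have "nondegenerate_curve I \<alpha>"
    unfolding nondegenerate_curve_def
  proof (intro ballI allI impI)
    fix t x y z
    assume t: "t \<in> I" and "x *\<^sub>R curve_deriv 1 \<alpha> t + y *\<^sub>R curve_deriv 2 \<alpha> t + z *\<^sub>R curve_deriv 3 \<alpha> t = 0"
    then have "L ((x * e) *\<^sub>R curve_deriv 1 \<gamma> (e * t + c) + (y * e ^ 2) *\<^sub>R curve_deriv 2 \<gamma> (e * t + c)
        + (z * e ^ 3) *\<^sub>R curve_deriv 3 \<gamma> (e * t + c)) = 0"
      by (simp add: cd linear_add[OF L] linear_scale[OF L])
    from inj[OF this] \<gamma> maps[OF t] have "x * e = 0 \<and> y * e ^ 2 = 0 \<and> z * e ^ 3 = 0"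
      unfolding pseudo_arc_null_curve_def nondegenerate_curve_def by blast
    then show "x = 0 \<and> y = 0 \<and> z = 0"
      using e0 by simp
  qed
  ultimately show "pseudo_arc_null_curve I \<alpha>"
    using \<gamma> I gram maps
    by (auto simp: pseudo_arc_null_curve_def null_curve_def pseudo_arc_param_def)
  show "t \<in> I \<Longrightarrow> torsion \<alpha> t = torsion \<gamma> (e * t + c)"
    using gram by (simp add: torsion_def)
qed

section \<open>Gram relations along a curve and its fourth derivative\<close>

lemma minkowski_has_vector_derivative:
  assumes "(X has_vector_derivative X') (at t)" "(Y has_vector_derivative Y') (at t)"
  shows "((\<lambda>s. minkowski (X s) (Y s)) has_vector_derivative
           minkowski (X t) Y' + minkowski X' (Y t)) (at t)"
  by (rule minkowski.has_vector_derivative[OF assms])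

lemma minkowski_constant_derivative:
  assumes "open I" "t \<in> I" "\<And>s. s \<in> I \<Longrightarrow> minkowski (X s) (Y s) = k"
    and "(X has_vector_derivative X') (at t)" "(Y has_vector_derivative Y') (at t)"
  shows "minkowski (X t) Y' + minkowski X' (Y t) = 0"
proof -
  have "((\<lambda>_. k) has_vector_derivative minkowski (X t) Y' + minkowski X' (Y t)) (at t)"
    using minkowski_has_vector_derivative[OF assms(4,5)] assms(1,2)
    by (rule has_vector_derivative_transform_within_open) (rule assms(3))
  then show ?thesis
    using vector_derivative_unique_at[OF _ has_vector_derivative_const] by blast
qed

text \<open>Write T, N, D, E for the derivatives of orders 1 to 4. Differentiating g(T,T) = 0 gives
  g(T,N) = 0, and then g(T,D) = -1; differentiating g(N,N) = 1 gives g(N,D) = 0. One more derivative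
  of the last two relations gives g(T,E) = 0 and g(N,E) = -g(D,D), so E can be expanded in the
  frame.\<close>

lemma pseudo_arc_null_curve_frame:
  assumes \<alpha>: "pseudo_arc_null_curve I \<alpha>" and t: "t \<in> I"
  shows "null_frame (curve_deriv 1 \<alpha> t) (curve_deriv 2 \<alpha> t) (curve_deriv 3 \<alpha> t) (torsion \<alpha> t)"
    and "\<exists>h. (torsion \<alpha> has_vector_derivative h) (at t) \<and>
           curve_deriv 4 \<alpha> t = - h *\<^sub>R curve_deriv 1 \<alpha> t - (2 * torsion \<alpha> t) *\<^sub>R curve_deriv 2 \<alpha> t"
proof -
  have I: "open I" and sm: "smooth_curve I \<alpha>"
    and tt: "\<And>s. s \<in> I \<Longrightarrow> minkowski (curve_deriv 1 \<alpha> s) (curve_deriv 1 \<alpha> s) = 0"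
    and nn: "\<And>s. s \<in> I \<Longrightarrow> minkowski (curve_deriv 2 \<alpha> s) (curve_deriv 2 \<alpha> s) = 1"
    using \<alpha> by (auto simp: pseudo_arc_null_curve_def null_curve_def pseudo_arc_param_def
      open_interval_def)
  note d1 = smooth_curve_derivs(1)[OF sm] and d2 = smooth_curve_derivs(2)[OF sm]
    and d3 = smooth_curve_derivs(3)[OF sm]
  note mc = minkowski_constant_derivative[OF I]
  have tn: "minkowski (curve_deriv 1 \<alpha> s) (curve_deriv 2 \<alpha> s) = 0" if "s \<in> I" for s
    using mc[OF that tt d1[OF that] d1[OF that]]
    by (simp add: minkowski_commute[of "curve_deriv 2 \<alpha> s"])
  have td: "minkowski (curve_deriv 1 \<alpha> s) (curve_deriv 3 \<alpha> s) = - 1" if "s \<in> I" for s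
    using mc[OF that tn d1[OF that] d2[OF that]] nn[OF that] by simp
  have nd: "minkowski (curve_deriv 2 \<alpha> s) (curve_deriv 3 \<alpha> s) = 0" if "s \<in> I" for s
    using mc[OF that nn d2[OF that] d2[OF that]]
    by (simp add: minkowski_commute[of "curve_deriv 3 \<alpha> s"])
  have te: "minkowski (curve_deriv 4 \<alpha> t) (curve_deriv 1 \<alpha> t) = 0"
    using mc[OF t td d1[OF t] d3[OF t]] nd[OF t]
    by (simp add: minkowski_commute[of "curve_deriv 4 \<alpha> t" "curve_deriv 1 \<alpha> t"])
  have ne: "minkowski (curve_deriv 4 \<alpha> t) (curve_deriv 2 \<alpha> t) = - (2 * torsion \<alpha> t)"
    using mc[OF t nd d2[OF t] d3[OF t]]
    by (simp add: torsion_def minkowski_commute[of "curve_deriv 4 \<alpha> t" "curve_deriv 2 \<alpha> t"])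
  show F: "null_frame (curve_deriv 1 \<alpha> t) (curve_deriv 2 \<alpha> t) (curve_deriv 3 \<alpha> t) (torsion \<alpha> t)"
    unfolding null_frame_def using tt[OF t] tn[OF t] nn[OF t] td[OF t] nd[OF t]
    by (simp add: torsion_def)
  \<comment> \<open>The last unknown pairing in the expansion of the fourth derivative; it is the
    derivative of the torsion, because the torsion is half of g(D,D).\<close>
  define h where "h = minkowski (curve_deriv 4 \<alpha> t) (curve_deriv 3 \<alpha> t)"
  have "((\<lambda>s. (1/2) *\<^sub>R minkowski (curve_deriv 3 \<alpha> s) (curve_deriv 3 \<alpha> s)) has_vector_derivative
      (1/2) *\<^sub>R (minkowski (curve_deriv 3 \<alpha> t) (curve_deriv 4 \<alpha> t)
        + minkowski (curve_deriv 4 \<alpha> t) (curve_deriv 3 \<alpha> t))) (at t)"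
    by (intro bounded_linear.has_vector_derivative[OF bounded_linear_scaleR_right]
      minkowski_has_vector_derivative d3 t)
  then have "(torsion \<alpha> has_vector_derivative h) (at t)"
    by (simp add: torsion_def[abs_def] h_def minkowski_commute[of "curve_deriv 3 \<alpha> t" "curve_deriv 4 \<alpha> t"])
  moreover have "curve_deriv 4 \<alpha> t = - h *\<^sub>R curve_deriv 1 \<alpha> t - (2 * torsion \<alpha> t) *\<^sub>R curve_deriv 2 \<alpha> t"
    using null_frame_expansion[OF F, of "curve_deriv 4 \<alpha> t"] unfolding te ne h_def[symmetric]
    by simp
  ultimately show "\<exists>h. (torsion \<alpha> has_vector_derivative h) (at t) \<and>
      curve_deriv 4 \<alpha> t = - h *\<^sub>R curve_deriv 1 \<alpha> t - (2 * torsion \<alpha> t) *\<^sub>R curve_deriv 2 \<alpha> t"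
    by blast
qed

section \<open>Congruence of curves with equal torsion\<close>

lemma has_vector_derivative_zero_on_interval:
  fixes f :: "real \<Rightarrow> 'a :: real_normed_vector"
  assumes "open_interval I" "\<And>t. t \<in> I \<Longrightarrow> (f has_vector_derivative 0) (at t)"
  shows "\<exists>k. \<forall>t\<in>I. f t = k"
proof -
  have "convex I"
    using assms(1) by (simp add: open_interval_def is_interval_convex_1)
  then show ?thesis
    using has_vector_derivative_zero_constant[of I f] has_vector_derivative_at_within[OF assms(2)]
    by metis
qed

text \<open>The map between the frames is one fixed linear isometry that takes \<beta>' to
  \<alpha>'. Hence \<alpha> minus the image of \<beta> has zero derivative, and integration leaves
  only a translation.\<close>

theorem pseudo_arc_null_curve_rigid:
  assumes \<alpha>: "pseudo_arc_null_curve I \<alpha>" and \<beta>: "pseudo_arc_null_curve I \<beta>"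
    and tor: "\<And>t. t \<in> I \<Longrightarrow> torsion \<alpha> t = torsion \<beta> t"
  obtains F where "minkowski_isometry F" "\<And>t. t \<in> I \<Longrightarrow> \<alpha> t = F (\<beta> t)"
proof -
  have oi: "open_interval I" and sm: "smooth_curve I \<alpha>" "smooth_curve I \<beta>"
    using \<alpha> \<beta> by (auto simp: pseudo_arc_null_curve_def null_curve_def)
  then have I: "open I" and ne: "I \<noteq> {}"
    by (auto simp: open_interval_def)
  define k where "k = torsion \<beta>"
  define M where "M = (\<lambda>t. frame_map (curve_deriv 1 \<beta> t) (curve_deriv 2 \<beta> t) (curve_deriv 3 \<beta> t)
    (curve_deriv 1 \<alpha> t) (curve_deriv 2 \<alpha> t) (curve_deriv 3 \<alpha> t) (k t))"
  note F\<alpha> = pseudo_arc_null_curve_frame[OF \<alpha>] and F\<beta> = pseudo_arc_null_curve_frame[OF \<beta>]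
  have M_const: "((\<lambda>t. M t v) has_vector_derivative 0) (at t)" if t: "t \<in> I" for t v
  proof -
    obtain h where h: "(torsion \<beta> has_vector_derivative h) (at t)"
      "curve_deriv 4 \<beta> t = - h *\<^sub>R curve_deriv 1 \<beta> t - (2 * k t) *\<^sub>R curve_deriv 2 \<beta> t"
      using F\<beta>(2)[OF t] by (auto simp: k_def)
    obtain h' where h': "(torsion \<alpha> has_vector_derivative h') (at t)"
      "curve_deriv 4 \<alpha> t = - h' *\<^sub>R curve_deriv 1 \<alpha> t - (2 * k t) *\<^sub>R curve_deriv 2 \<alpha> t"
      using F\<alpha>(2)[OF t] tor[OF t] by (auto simp: k_def)
    \<comment> \<open>The torsions agree on the open set \<open>I\<close>, so their derivatives at
      \<open>t\<close> agree and both frames obey the same linear equation.\<close>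
    have "(torsion \<beta> has_vector_derivative h') (at t)"
      using h'(1) I t by (rule has_vector_derivative_transform_within_open) (rule tor)
    then have hh: "h' = h"
      using h(1) vector_derivative_unique_at by blast
    have dk: "(k has_field_derivative h) (at t)"
      using h(1) by (simp add: k_def has_real_derivative_iff_has_vector_derivative)
    have g: "((\<lambda>t. minkowski v (X t)) has_field_derivative minkowski v X') (at t)"
      if "(X has_vector_derivative X') (at t)" for X X'
      using minkowski_has_vector_derivative[OF has_vector_derivative_const that, of v]
      by (simp add: has_real_derivative_iff_has_vector_derivative minkowski.zero_left)
    note d\<alpha> = smooth_curve_derivs[OF sm(1) t] and d\<beta> = smooth_curve_derivs[OF sm(2) t]
    \<comment> \<open>After substitution of the two fourth derivatives, the coefficients of
      \<alpha>', \<alpha>'' and \<alpha>''' cancel separately.\<close>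
    show ?thesis
      unfolding M_def frame_map_def
      by ((rule derivative_eq_intros dk g d\<alpha> d\<beta> refl)+)
        (simp add: h(2) h'(2) hh minkowski_linear minkowski.minus_right algebra_simps)
  qed
  obtain t0 where t0: "t0 \<in> I"
    using ne by blast
  have M_eq: "M t v = M t0 v" if "t \<in> I" for t v
    using has_vector_derivative_zero_on_interval[OF oi M_const[where v = v]] that t0 by auto
  have lin: "linear (M t0)"
    unfolding M_def by (rule linear_frame_map)
  have iso: "minkowski (M t0 v) (M t0 w) = minkowski v w" for v w
    unfolding M_def using F\<beta>(1)[OF t0] F\<alpha>(1)[OF t0] tor[OF t0]
    by (intro frame_map_isometric) (auto simp: k_def)
  \<comment> \<open>The map at time \<open>t\<close> sends the tangent of \<beta> at
    \<open>t\<close> to that of \<alpha>; by constancy the map at \<open>t0\<close> does the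
    same.\<close>
  have tangent: "M t0 (curve_deriv 1 \<beta> t) = curve_deriv 1 \<alpha> t" if t: "t \<in> I" for t
    unfolding M_eq[OF t, symmetric]
    by (simp add: M_def frame_map_def null_frame_gram[OF F\<beta>(1)[OF t]])
  have "((\<lambda>t. \<alpha> t - M t0 (\<beta> t)) has_vector_derivative 0) (at t)" if t: "t \<in> I" for t
  proof -
    have "((\<lambda>t. \<alpha> t - M t0 (\<beta> t)) has_vector_derivative
        curve_deriv 1 \<alpha> t - M t0 (curve_deriv 1 \<beta> t)) (at t)"
      using lin unfolding linear_conv_bounded_linear
      by (rule has_vector_derivative_diff[OF smooth_curve_derivs(4)[OF sm(1) t]
        bounded_linear.has_vector_derivative[OF _ smooth_curve_derivs(4)[OF sm(2) t]]])
    then show ?thesis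
      by (simp add: tangent[OF t])
  qed
  from has_vector_derivative_zero_on_interval[OF oi this]
  obtain b where b: "\<And>t. t \<in> I \<Longrightarrow> \<alpha> t - M t0 (\<beta> t) = b"
    by metis
  show ?thesis
  proof
    show "minkowski_isometry (\<lambda>p. M t0 p + b)"
      unfolding minkowski_isometry_def using lin iso by blast
    show "\<alpha> t = M t0 (\<beta> t) + b" if "t \<in> I" for t
      using b[OF that] by (simp add: algebra_simps)
  qed
qed

section \<open>The Airy curve\<close>

text \<open>Coordinates in which the light cone is \<open>x\<^sup>2 = y z\<close>.\<close>

definition cone_vec :: "real \<Rightarrow> real \<Rightarrow> real \<Rightarrow> real ^ 3" where
  "cone_vec x y z =
     x *\<^sub>R vector [1, 0, 0] + y *\<^sub>R vector [0, 1/2, 1/2] + z *\<^sub>R vector [0, - 1/2, 1/2]"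

lemma minkowski_cone_vec:
  "minkowski (cone_vec x y z) (cone_vec x' y' z') = x * x' - (y * z' + z * y') / 2"
  by (simp add: minkowski_def cone_vec_def field_simps)

lemma cone_vec_has_vector_derivative:
  assumes "(x has_field_derivative x') (at t)" "(y has_field_derivative y') (at t)"
    "(z has_field_derivative z') (at t)"
  shows "((\<lambda>s. cone_vec (x s) (y s) (z s)) has_vector_derivative cone_vec x' y' z') (at t)"
  unfolding cone_vec_def by (rule derivative_eq_intros assms refl | simp)+

lemma cone_vec_linear:
  "a *\<^sub>R cone_vec x y z + b *\<^sub>R cone_vec x' y' z'
     = cone_vec (a * x + b * x') (a * y + b * y') (a * z + b * z')"
  by (simp add: cone_vec_def algebra_simps)

text \<open>Retains two facts about the rescaled Airy functions: both solve w'' = l s w, and their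
  Wronskian is 1.\<close>

locale airy_pair =
  fixes l :: real and p p' q q' :: "real \<Rightarrow> real"
  assumes l: "l \<noteq> 0"
    and dp: "(p has_field_derivative p' s) (at s)" "(p' has_field_derivative l * s * p s) (at s)"
    and dq: "(q has_field_derivative q' s) (at s)" "(q' has_field_derivative l * s * q s) (at s)"
    and wronskian: "p s * q' s - p' s * q s = 1"
begin

text \<open>An explicit antiderivative of \<open>curve1\<close>: for two solutions u, v of w'' = l s
  w, the derivative of s u v - u' v' / l is u v, since the terms containing s cancel.\<close>

definition curve :: "real \<Rightarrow> real ^ 3" where
  "curve s = cone_vec (s * p s * q s - p' s * q' s / l) (s * q s ^ 2 - q' s ^ 2 / l)
     (s * p s ^ 2 - p' s ^ 2 / l)"

definition curve1 :: "real \<Rightarrow> real ^ 3" where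
  "curve1 s = cone_vec (p s * q s) (q s ^ 2) (p s ^ 2)"

definition curve2 :: "real \<Rightarrow> real ^ 3" where
  "curve2 s = cone_vec (p' s * q s + p s * q' s) (2 * q s * q' s) (2 * p s * p' s)"

definition curve3 :: "real \<Rightarrow> real ^ 3" where
  "curve3 s = cone_vec (2 * l * s * p s * q s + 2 * p' s * q' s)
     (2 * l * s * q s ^ 2 + 2 * q' s ^ 2) (2 * l * s * p s ^ 2 + 2 * p' s ^ 2)"

text \<open>A product f of two solutions of w'' = l s w satisfies f''' = 4 l s f' + 2 l f. Each
  coordinate of \<open>curve1\<close> is such a product, which gives the last claim.\<close>

lemma curve_derivs:
  "(curve has_vector_derivative curve1 s) (at s)"
  "(curve1 has_vector_derivative curve2 s) (at s)"
  "(curve2 has_vector_derivative curve3 s) (at s)"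
  "(curve3 has_vector_derivative (2 * l) *\<^sub>R curve1 s + (4 * l * s) *\<^sub>R curve2 s) (at s)"
proof -
  show "(curve has_vector_derivative curve1 s) (at s)"
    unfolding curve_def[abs_def] curve1_def
    by (rule cone_vec_has_vector_derivative; (rule derivative_eq_intros dp dq refl l)+;
        use l in \<open>simp add: field_simps power2_eq_square\<close>)
  show "(curve1 has_vector_derivative curve2 s) (at s)"
    unfolding curve1_def[abs_def] curve2_def
    by (rule cone_vec_has_vector_derivative; (rule derivative_eq_intros dp dq refl)+;
        simp add: algebra_simps power2_eq_square)
  show "(curve2 has_vector_derivative curve3 s) (at s)"
    unfolding curve2_def[abs_def] curve3_def
    by (rule cone_vec_has_vector_derivative; (rule derivative_eq_intros dp dq refl)+;
        simp add: algebra_simps power2_eq_square)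
  show "(curve3 has_vector_derivative (2 * l) *\<^sub>R curve1 s + (4 * l * s) *\<^sub>R curve2 s) (at s)"
    unfolding curve3_def[abs_def] curve1_def curve2_def cone_vec_linear
    by (rule cone_vec_has_vector_derivative; (rule derivative_eq_intros dp dq refl)+;
        simp add: algebra_simps power2_eq_square)
qed

section \<open>Smoothness of the model curve\<close>

lemma curve_deriv_curve:
  "curve_deriv 1 curve = curve1" "curve_deriv 2 curve = curve2" "curve_deriv 3 curve = curve3"
proof -
  have step: "curve_deriv (n + 1) curve = f'"
    if "curve_deriv n curve = f" "\<And>s. (f has_vector_derivative f' s) (at s)" for n f f'
    using curve_deriv_Suc[of n curve] vector_derivative_at[OF that(2)] that(1)
    by (simp add: fun_eq_iff flip: Suc_eq_plus1)
  show 1: "curve_deriv 1 curve = curve1"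
    using step[OF curve_deriv_0 curve_derivs(1)] by simp
  show 2: "curve_deriv 2 curve = curve2"
    using step[OF 1 curve_derivs(2)] by simp
  show "curve_deriv 3 curve = curve3"
    using step[OF 2 curve_derivs(3)] by simp
qed

text \<open>The fourth-order relation differentiated \<open>n\<close> times: each differentiation of
  the factor \<open>4 * l * s\<close> adds \<open>4 * l\<close> to the first coefficient. Existence
  of the derivatives is carried through the same induction.\<close>

lemma curve_deriv_step:
  "(curve_deriv (n + 3) curve has_vector_derivative curve_deriv (n + 4) curve s) (at s) \<and>
   curve_deriv (n + 4) curve s
     = (2 * l * (2 * real n + 1)) *\<^sub>R curve_deriv (n + 1) curve s + (4 * l * s) *\<^sub>R curve_deriv (n + 2) curve s"
proof (induction n arbitrary: s rule: less_induct)
  case (less n)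
  \<comment> \<open>Orders 1 and 2 come from the explicit formulas, higher ones from the induction
    hypothesis at \<open>k - 3\<close>.\<close>
  have low: "(curve_deriv k curve has_vector_derivative curve_deriv (k + 1) curve s) (at s)"
    if "k < n + 3" "k > 0" for k s
  proof -
    have "k = 1 \<or> k = 2 \<or> k - 3 < n \<and> k = (k - 3) + 3"
      using that by arith
    then consider "k = 1" | "k = 2" | "k - 3 < n" "k = (k - 3) + 3"
      by blast
    then show ?thesis
    proof cases
      case 1
      then show ?thesis using curve_derivs(2) by (simp add: curve_deriv_curve)
    next
      case 2
      then show ?thesis using curve_derivs(3) by (simp add: curve_deriv_curve)
    next
      case 3
      have "k - 3 + 4 = k + 1"
        using 3(2) by linarith
      with conjunct1[OF less.IH[OF 3(1), of s]] show ?thesis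
        by (simp only: 3(2)[symmetric])
    qed
  qed
  have D: "(curve_deriv (n + 3) curve has_vector_derivative
      (2 * l * (2 * real n + 1)) *\<^sub>R curve_deriv (n + 1) curve s
        + (4 * l * s) *\<^sub>R curve_deriv (n + 2) curve s) (at s)" for s
  proof (cases n)
    case 0
    then show ?thesis using curve_derivs(4) by (simp only: 0 add_0 curve_deriv_curve) simp
  next
    case (Suc m)
    \<comment> \<open>The hypothesis at \<open>m = n - 1\<close>, read as an equality of functions
      so that both sides can be differentiated.\<close>
    have eq: "curve_deriv (n + 3) curve = (\<lambda>s. (2 * l * (2 * real m + 1)) *\<^sub>R curve_deriv n curve s
        + (4 * l * s) *\<^sub>R curve_deriv (n + 1) curve s)"
    proof -
      have idx: "m + 4 = n + 3" "m + 2 = n + 1" "m + 1 = n" and "m < n"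
        using Suc by simp_all
      from conjunct2[OF less.IH[OF this(4)], unfolded idx] show ?thesis
        by (rule ext)
    qed
    have 1: "(curve_deriv n curve has_vector_derivative curve_deriv (n + 1) curve s) (at s)"
      "(curve_deriv (n + 1) curve has_vector_derivative curve_deriv (n + 2) curve s) (at s)"
      using low[of n s] low[of "n + 1" s] Suc by (simp_all only: add.assoc one_add_one)
    show ?thesis
      unfolding eq
      by ((rule derivative_eq_intros 1 refl)+)
        (simp add: Suc algebra_simps flip: scaleR_left_distrib)
  qed
  from vector_derivative_at[OF D]
  have "curve_deriv (n + 4) curve s = (2 * l * (2 * real n + 1)) *\<^sub>R curve_deriv (n + 1) curve s
        + (4 * l * s) *\<^sub>R curve_deriv (n + 2) curve s" for s
    using curve_deriv_Suc[of "n + 3" curve s] by (simp add: add.commute[of n 4])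
  then show ?case
    using D by simp
qed

lemma smooth_curve_curve: "smooth_curve I curve"
proof (rule smooth_curveI)
  fix n :: nat and t
  have "n = 0 \<or> n = 1 \<or> n = 2 \<or> n = (n - 3) + 3"
    by arith
  then consider "n = 0" | "n = 1" | "n = 2" | "n = (n - 3) + 3"
    by blast
  then show "\<exists>v. (curve_deriv n curve has_vector_derivative v) (at t)"
  proof cases
    case 4
    then show ?thesis
      using curve_deriv_step[of "n - 3" t] by metis
  qed (use curve_derivs curve_deriv_curve in \<open>auto simp del: One_nat_def\<close>)
qed

text \<open>Every pairing either vanishes identically or is a multiple of the squared Wronskian,
  with factor 1, -1 or -4 l s.\<close>

lemma curve_frame: "null_frame (curve1 s) (curve2 s) (curve3 s) (- 2 * l * s)"
proof -
  have "minkowski (curve3 s) (curve3 s) = - 4 * l * s * (p s * q' s - p' s * q s)\<^sup>2"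
    unfolding curve3_def minkowski_cone_vec by (simp add: power2_eq_square field_simps)
  moreover have "(p s * q' s - p' s * q s)\<^sup>2 = 1"
    by (simp add: wronskian)
  moreover from this have "minkowski (curve1 s) (curve1 s) = 0" "minkowski (curve1 s) (curve2 s) = 0"
    "minkowski (curve2 s) (curve2 s) = 1" "minkowski (curve1 s) (curve3 s) = - 1"
    "minkowski (curve2 s) (curve3 s) = 0"
    unfolding curve1_def curve2_def curve3_def minkowski_cone_vec
    by (simp_all add: power2_eq_square field_simps)
  ultimately show ?thesis
    unfolding null_frame_def by simp
qed

lemma pseudo_arc_null_curve_curve:
  assumes "open_interval I"
  shows "pseudo_arc_null_curve I curve"
  using assms smooth_curve_curve null_frame_gram[OF curve_frame] null_frame_independent[OF curve_frame]
  unfolding pseudo_arc_null_curve_def null_curve_def nondegenerate_curve_def pseudo_arc_param_def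
    curve_deriv_curve by blast

lemma torsion_curve: "torsion curve s = - 2 * l * s"
  unfolding torsion_def curve_deriv_curve null_frame_gram[OF curve_frame] by simp

end

text \<open>Rescaling the argument by \<open>m\<close> turns w'' = u w into w'' = m^3 s w. The
  factor \<open>pi / m\<close> on Bi compensates the chain-rule factor \<open>m\<close> and the Airy
  Wronskian \<open>1 / pi\<close>.\<close>

lemma airy_pair_airy:
  assumes "m \<noteq> 0"
  shows "airy_pair (m ^ 3) (\<lambda>s. airy_Ai (m * s)) (\<lambda>s. m * deriv airy_Ai (m * s))
           (\<lambda>s. pi / m * airy_Bi (m * s)) (\<lambda>s. pi * deriv airy_Bi (m * s))"
proof
  fix s
  have chain: "((\<lambda>s. f (m * s)) has_field_derivative f' * m) (at s)"
    if "(f has_field_derivative f') (at (m * s))" for f f'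
    by (rule DERIV_chain2[where f = f and g = "\<lambda>s. m * s" and x = s, OF that]) (auto intro!: derivative_eq_intros)
  show "((\<lambda>s. airy_Ai (m * s)) has_field_derivative m * deriv airy_Ai (m * s)) (at s)"
    using chain[OF airy_Ai_ode(1)] by (simp add: mult.commute)
  show "((\<lambda>s. m * deriv airy_Ai (m * s)) has_field_derivative m ^ 3 * s * airy_Ai (m * s)) (at s)"
    using DERIV_cmult[OF chain[OF airy_Ai_ode(2)], of m] by (simp add: power3_eq_cube mult_ac)
  show "((\<lambda>s. pi / m * airy_Bi (m * s)) has_field_derivative pi * deriv airy_Bi (m * s)) (at s)"
    using DERIV_cmult[OF chain[OF airy_Bi_ode(1)], of "pi / m"] assms by (simp add: mult_ac)
  show "((\<lambda>s. pi * deriv airy_Bi (m * s)) has_field_derivative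
      m ^ 3 * s * (pi / m * airy_Bi (m * s))) (at s)"
    using DERIV_cmult[OF chain[OF airy_Bi_ode(2)], of pi] assms
    by (simp add: power3_eq_cube mult_ac)
  have "pi * (airy_Ai (m * s) * deriv airy_Bi (m * s) - deriv airy_Ai (m * s) * airy_Bi (m * s)) = 1"
    by (simp add: airy_wronskian)
  then show "airy_Ai (m * s) * (pi * deriv airy_Bi (m * s))
      - m * deriv airy_Ai (m * s) * (pi / m * airy_Bi (m * s)) = 1"
    using assms by (simp add: algebra_simps)
qed (use assms in simp)

text \<open>The second and third components of the Airy curve are half the difference and half the
  sum of the last two cone coordinates.\<close>

lemma airy_null_curve_eq:
  assumes "lam \<noteq> 0"
  defines "m \<equiv> root 3 lam"
  shows "airy_null_curve lam = airy_pair.curve (m ^ 3) (\<lambda>s. airy_Ai (m * s))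
    (\<lambda>s. m * deriv airy_Ai (m * s)) (\<lambda>s. pi / m * airy_Bi (m * s)) (\<lambda>s. pi * deriv airy_Bi (m * s))"
proof -
  have m: "m \<noteq> 0"
    using assms by simp
  then show ?thesis
    unfolding airy_pair.curve_def[OF airy_pair_airy[OF m], abs_def]
    by (auto simp: fun_eq_iff airy_null_curve_def Let_def cone_vec_def vec_eq_iff forall_3
      simp flip: m_def) (simp_all add: field_simps power2_eq_square power3_eq_cube)
qed

lemma airy_null_curve_properties:
  assumes "lam \<noteq> 0"
  shows "open_interval J \<Longrightarrow> pseudo_arc_null_curve J (airy_null_curve lam)"
    and "torsion (airy_null_curve lam) s = - 2 * lam * s"
proof -
  \<comment> \<open>The root is of odd order, so its cube is \<open>lam\<close> for negative
    \<open>lam\<close> as well.\<close>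
  have "root 3 lam \<noteq> 0" and cube: "root 3 lam ^ 3 = lam"
    using assms by (simp_all add: odd_real_root_pow)
  then interpret airy_pair "root 3 lam ^ 3" "\<lambda>s. airy_Ai (root 3 lam * s)"
    "\<lambda>s. root 3 lam * deriv airy_Ai (root 3 lam * s)"
    "\<lambda>s. pi / root 3 lam * airy_Bi (root 3 lam * s)" "\<lambda>s. pi * deriv airy_Bi (root 3 lam * s)"
    by (intro airy_pair_airy)
  show "open_interval J \<Longrightarrow> pseudo_arc_null_curve J (airy_null_curve lam)"
    unfolding airy_null_curve_eq[OF assms] by (rule pseudo_arc_null_curve_curve)
  show "torsion (airy_null_curve lam) s = - 2 * lam * s"
    unfolding airy_null_curve_eq[OF assms] using torsion_curve[of s] by (simp only: cube)
qed

section \<open>The classification\<close>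

lemma pseudo_arc_changeE:
  assumes "pseudo_arc_change \<phi>"
  obtains e c where "e = 1 \<or> e = - 1" "\<phi> = (\<lambda>s. e * s + c)"
  using assms unfolding pseudo_arc_change_def by (metis mult_1 mult_minus1)

text \<open>As e * e = 1, the inverse of s -> e s + c is s -> e s - e c. Writing the constant as
  \<open>+ - e * c\<close> keeps the shape of an affine change with the same
  \<open>e\<close>.\<close>

lemma pseudo_arc_change_inverse:
  assumes "e = 1 \<or> e = (- 1 :: real)"
  shows "e * (e * s + c) + - e * c = s" "e * (e * s + - e * c) + c = s"
    and "pseudo_arc_change (\<lambda>s. e * s + - e * c)"
proof -
  show "e * (e * s + c) + - e * c = s" "e * (e * s + - e * c) + c = s"
    using assms by auto
  show "pseudo_arc_change (\<lambda>s. e * s + - e * c)"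
    unfolding pseudo_arc_change_def using assms by (intro exI[of _ "- e * c"]) auto
qed

lemma open_interval_vimage:
  assumes "open_interval I" "e = 1 \<or> e = (- 1 :: real)"
  shows "open_interval ((\<lambda>s. e * s + c) -` I)"
proof -
  have "open ((\<lambda>s. e * s + c) -` I)"
    using assms(1) by (intro open_vimage continuous_intros) (simp add: open_interval_def)
  moreover have "is_interval ((\<lambda>s. e * s + c) -` I)"
    unfolding is_interval_1
  proof (intro ballI allI impI)
    fix a b x
    assume ab: "a \<in> (\<lambda>s. e * s + c) -` I" "b \<in> (\<lambda>s. e * s + c) -` I" and x: "a \<le> x \<and> x \<le> b"
    have I: "\<And>a b x. a \<in> I \<Longrightarrow> b \<in> I \<Longrightarrow> a \<le> x \<Longrightarrow> x \<le> b \<Longrightarrow> x \<in> I"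
      using assms(1) unfolding open_interval_def is_interval_1 by blast
    \<comment> \<open>The affine map preserves order for \<open>e = 1\<close> and reverses it for
      \<open>e = - 1\<close>, hence the two instances with endpoints exchanged.\<close>
    show "x \<in> (\<lambda>s. e * s + c) -` I"
      using assms(2) I[of "a + c" "b + c" "x + c"] I[of "- b + c" "- a + c" "- x + c"] ab x by auto
  qed
  moreover have "(\<lambda>s. e * s + c) -` I \<noteq> {}"
  proof -
    obtain y where "y \<in> I"
      using assms(1) by (auto simp: open_interval_def)
    then have "e * (e * (y - c)) + c \<in> I"
      using assms(2) by auto
    then show ?thesis
      by blast
  qed
  ultimately show ?thesis
    by (simp add: open_interval_def)
qed

text \<open>A shift or reversal of the parameter alters the expression \<open>- 2 * lam * s\<close>,
  so the torsion is prescribed in some admissible parameter \<open>\<psi>\<close>; both sides of the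
  equivalence are then invariant under parameter changes.\<close>

theorem corollary3:
  fixes lam :: real
  assumes "lam \<noteq> 0"
  shows "(\<forall>J. open_interval J \<longrightarrow>
            pseudo_arc_null_curve J (airy_null_curve lam) \<and>
            (\<forall>s\<in>J. torsion (airy_null_curve lam) s = - 2 * lam * s))
       \<and> (\<forall>I \<alpha>.
            pseudo_arc_null_curve I \<alpha> \<and>
            (\<exists>\<psi>. pseudo_arc_change \<psi> \<and> (\<forall>s\<in>\<psi> -` I. torsion (\<alpha> \<circ> \<psi>) s = - 2 * lam * s))
          \<longleftrightarrow> (\<exists>J. open_interval J \<and> equivalent_curves I \<alpha> J (airy_null_curve lam)))"
proof (intro conjI allI impI ballI iffI)
  fix J assume "open_interval J"
  then show "pseudo_arc_null_curve J (airy_null_curve lam)"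
    by (rule airy_null_curve_properties[OF assms])
next
  fix s show "torsion (airy_null_curve lam) s = - 2 * lam * s"
    by (rule airy_null_curve_properties[OF assms])
next
  fix I \<alpha>
  assume asm: "pseudo_arc_null_curve I \<alpha> \<and>
    (\<exists>\<psi>. pseudo_arc_change \<psi> \<and> (\<forall>s\<in>\<psi> -` I. torsion (\<alpha> \<circ> \<psi>) s = - 2 * lam * s))"
  then obtain \<psi> where \<alpha>: "pseudo_arc_null_curve I \<alpha>" and \<psi>: "pseudo_arc_change \<psi>"
    and tor: "\<And>s. s \<in> \<psi> -` I \<Longrightarrow> torsion (\<alpha> \<circ> \<psi>) s = - 2 * lam * s"
    by blast
  from \<psi> obtain e c where e: "e = 1 \<or> e = - 1" and \<psi>_eq: "\<psi> = (\<lambda>s. e * s + c)"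
    by (rule pseudo_arc_changeE)
  note inv = pseudo_arc_change_inverse(1,2)[OF e] and \<phi> = pseudo_arc_change_inverse(3)[OF e]
  define J where "J = \<psi> -` I"
  have "open_interval I"
    using \<alpha> by (simp add: pseudo_arc_null_curve_def null_curve_def)
  then have J: "open_interval J"
    unfolding J_def \<psi>_eq using e by (rule open_interval_vimage)
  \<comment> \<open>A pure change of parameter is the affine case with the identity as linear part
    and no translation.\<close>
  have "pseudo_arc_null_curve J (\<alpha> \<circ> \<psi>)"
    by (rule pseudo_arc_null_curve_affine(1)[OF \<alpha> J linear_id _ e, where b = 0])
      (auto simp: J_def \<psi>_eq)
  moreover have "pseudo_arc_null_curve J (airy_null_curve lam)"
    using assms J by (rule airy_null_curve_properties)
  ultimately obtain F where F: "minkowski_isometry F"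
    "\<And>s. s \<in> J \<Longrightarrow> (\<alpha> \<circ> \<psi>) s = F (airy_null_curve lam s)"
    by (rule pseudo_arc_null_curve_rigid) (auto simp: J_def tor airy_null_curve_properties[OF assms])
  \<comment> \<open>The rigidity isometry compares the curves in the parameter of \<open>J\<close>;
    the inverse of \<open>\<psi>\<close> brings the comparison back to \<open>I\<close>.\<close>
  have "(\<lambda>s. e * s + - e * c) ` I = J"
  proof
    show "(\<lambda>s. e * s + - e * c) ` I \<subseteq> J"
      unfolding J_def \<psi>_eq using inv(2) by auto
    show "J \<subseteq> (\<lambda>s. e * s + - e * c) ` I"
    proof
      fix s assume "s \<in> J"
      then show "s \<in> (\<lambda>s. e * s + - e * c) ` I"
        unfolding J_def \<psi>_eq by (intro image_eqI[of _ _ "e * s + c"]) (simp_all only: inv vimage_eq)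
    qed
  qed
  moreover have "\<alpha> t = F (airy_null_curve lam (e * t + - e * c))" if "t \<in> I" for t
  proof -
    have "e * t + - e * c \<in> J"
      unfolding J_def \<psi>_eq using that by (simp only: inv vimage_eq)
    from F(2)[OF this] show ?thesis
      unfolding \<psi>_eq o_def inv .
  qed
  ultimately show "\<exists>J. open_interval J \<and> equivalent_curves I \<alpha> J (airy_null_curve lam)"
    unfolding equivalent_curves_def using J \<phi> F(1) by blast
next
  fix I \<alpha>
  assume "\<exists>J. open_interval J \<and> equivalent_curves I \<alpha> J (airy_null_curve lam)"
  then obtain J \<phi> F where J: "open_interval J" and \<phi>: "pseudo_arc_change \<phi>"
    and F: "minkowski_isometry F" and im: "\<phi> ` I = J"
    and eq: "\<And>t. t \<in> I \<Longrightarrow> \<alpha> t = F (airy_null_curve lam (\<phi> t))"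
    unfolding equivalent_curves_def by blast
  from F obtain L b where L: "linear L" "\<And>v w. minkowski (L v) (L w) = minkowski v w"
    and F_eq: "F = (\<lambda>p. L p + b)"
    unfolding minkowski_isometry_def by blast
  from \<phi> obtain e c where e: "e = 1 \<or> e = - 1" and \<phi>_eq: "\<phi> = (\<lambda>s. e * s + c)"
    by (rule pseudo_arc_changeE)
  note inv = pseudo_arc_change_inverse(1,2)[OF e] and \<psi> = pseudo_arc_change_inverse(3)[OF e]
  \<comment> \<open>Equivalence only says that \<open>J\<close> is the image of \<open>I\<close>;
    injectivity of \<open>\<phi>\<close> turns \<open>I\<close> into a preimage, hence an open
    interval.\<close>
  have "I = \<phi> -` J"
  proof -
    have "inj \<phi>"
      unfolding \<phi>_eq by (rule injI) (metis inv(1))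
    then show ?thesis
      using im by (simp add: inj_vimage_image_eq flip: im)
  qed
  then have I: "open_interval I"
    unfolding \<phi>_eq using open_interval_vimage[OF J e] by simp
  have airy: "pseudo_arc_null_curve J (airy_null_curve lam)"
    using assms J by (rule airy_null_curve_properties)
  have maps: "e * t + c \<in> J" if "t \<in> I" for t
    using im that by (auto simp: \<phi>_eq)
  have \<alpha>_eq: "\<alpha> t = L (airy_null_curve lam (e * t + c)) + b" if "t \<in> I" for t
    using eq[OF that] by (simp add: F_eq \<phi>_eq)
  note transfer = pseudo_arc_null_curve_affine[OF airy I L e maps \<alpha>_eq]
  define K where "K = (\<lambda>s. e * s + - e * c) -` I"
  have "open_interval K"
    unfolding K_def using I e by (rule open_interval_vimage)
  \<comment> \<open>The change to \<open>\<alpha>\<close> and its inverse cancel, so the torsion of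
    the Airy curve is evaluated at \<open>s\<close> itself.\<close>
  have "torsion (\<alpha> \<circ> (\<lambda>s. e * s + - e * c)) s = - 2 * lam * s" if s: "s \<in> K" for s
  proof -
    have "torsion (\<alpha> \<circ> (\<lambda>s. e * s + - e * c)) s = torsion \<alpha> (e * s + - e * c)"
      by (rule pseudo_arc_null_curve_affine(2)[OF transfer(1) \<open>open_interval K\<close> linear_id, where b = 0])
        (use e s in \<open>auto simp: K_def\<close>)
    also have "\<dots> = torsion (airy_null_curve lam) (e * (e * s + - e * c) + c)"
      using s by (intro transfer(2)) (simp_all add: K_def)
    also have "\<dots> = - 2 * lam * s"
      unfolding inv by (rule airy_null_curve_properties[OF assms])
    finally show ?thesis .
  qed
  then show "\<exists>\<psi>. pseudo_arc_change \<psi> \<and> (\<forall>s\<in>\<psi> -` I. torsion (\<alpha> \<circ> \<psi>) s = - 2 * lam * s)"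
    unfolding K_def using \<psi> by blast
  show "pseudo_arc_null_curve I \<alpha>"
    by (rule transfer(1))
qed

end
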